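(* Let $Z$ be a completely regular Hausdorff countably compact space, let $E$ be a Banach space, and let $(f_n)_n$ be a uniformly bounded sequence of continuous functions from $Z$ into $E$. Suppose that the sequence $(f_n)_n$ $w^*$-pointwise converges to $0$ on $Z$. Then there exists a sequence $(g_k)_k$ of convex combinations of the functions $f_n$ (that is, $g_k\in\mathrm{conv}\{f_n: n\in\mathbb{N}\}$ for all $k$) which converges uniformly to $0$ on $Z$, that is, $\|g_k\|_\infty=\sup_{z\in Z}\|g_k(z)\|_E\to0$.
   Context: A sequence $(f_n)_n$ of continuous functions from a topological space $Z$ into a Banach space $E$ is said to $w^*$-pointwise converge to $0$ on $Z$ if for every $p\in B_{E^*}$ (the closed unit ball of the dual $E^*$) the real-valued sequence $(p\circ f_n)_n$ converges pointwise to $0$ on $Z$. A space is countably compact if every countable open cover has a finite subcover. $\mathrm{conv}$ denotes the convex hull. *)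

theory Defs
  imports "HOL-Analysis.Analysis"
begin

definition wstar_pointwise_null ::
    "(nat \<Rightarrow> 'z \<Rightarrow> 'e::real_normed_vector) \<Rightarrow> bool" where
  "wstar_pointwise_null f \<longleftrightarrow>
     (\<forall>p \<in> cball (0 :: 'e \<Rightarrow>\<^sub>L real) 1. \<forall>z. (\<lambda>n. blinfun_apply p (f n z)) \<longlonglongrightarrow> 0)"

end

theory Submission
  imports Defs
begin

text \<open>
  On a countably compact space the sup norm of a continuous function is attained, so by Hahn-Banach
  every continuous \<open>h\<close> is normed by a functional \<open>x \<mapsto> p (x z)\<close> along which
  the given sequence tends to \<open>0\<close>. If the closed convex hull of the sequence avoids
  \<open>0\<close>, Simons' argument gives a contradiction: put
  \<open>l = (\<Sum>k. 2\<^sup>-\<^sup>k\<^sup>-\<^sup>1 g\<^sub>k)\<close>, where \<open>g\<^sub>k\<close> lies in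
  the closed convex hull of the \<open>k\<close>-th tail and almost minimises the norm of the next partial
  sum. Comparing \<open>g\<^sub>k\<close> with the rescaled remainder of the series, which lies in the same
  hull, shows that the norms of the partial sums approach the norm of \<open>l\<close> no faster than
  \<open>2\<^sup>-\<^sup>k\<close>. Hence a functional norming \<open>l\<close> stays bounded away from
  \<open>0\<close> on points of every tail hull.
\<close>

section \<open>Sublinear functionals and the Hahn-Banach theorem\<close>

definition sublinear :: "('a::real_vector \<Rightarrow> real) \<Rightarrow> bool" where
  "sublinear q \<longleftrightarrow> (\<forall>x y. q (x + y) \<le> q x + q y) \<and> (\<forall>c x. c \<ge> 0 \<longrightarrow> q (c *\<^sub>R x) = c * q x)"

lemma sublinear_add: "sublinear q \<Longrightarrow> q (x + y) \<le> q x + q y"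
  and sublinear_scale: "sublinear q \<Longrightarrow> c \<ge> 0 \<Longrightarrow> q (c *\<^sub>R x) = c * q x"
  by (auto simp: sublinear_def)

lemma sublinear_zero: "sublinear q \<Longrightarrow> q 0 = 0"
  using sublinear_scale[of q 0 0] by simp

lemma sublinear_minus: "sublinear q \<Longrightarrow> - q (- x) \<le> q x"
  using sublinear_add[of q x "- x"] sublinear_zero[of q] by simp

lemma sublinear_norm: "sublinear norm"
  by (auto simp: sublinear_def norm_triangle_ineq)

text \<open>\<open>r\<close> is the largest sublinear functional below \<open>q\<close> whose value
  at \<open>- v\<close> is at most \<open>- q v\<close>. It serves twice: it forces minimal
  sublinear functionals to be odd, and it prescribes the value of a dominated linear functional at
  \<open>v\<close>.\<close>

lemma sublinear_shift:
  fixes q :: "'a::real_vector \<Rightarrow> real"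
  assumes q: "sublinear q"
  defines "r \<equiv> \<lambda>x v. INF t\<in>{0..}. q (x + t *\<^sub>R v) - t * q v"
  shows "sublinear (\<lambda>x. r x v)" "r x v \<le> q x" "r (- v) v \<le> - q v"
proof -
  have bdd: "bdd_below ((\<lambda>t. q (x + t *\<^sub>R v) - t * q v) ` {0..})" for x
  proof (rule bdd_belowI2)
    fix t :: real assume "t \<in> {0..}"
    then show "- q (- x) \<le> q (x + t *\<^sub>R v) - t * q v"
      using sublinear_add[OF q, of "x + t *\<^sub>R v" "- x"] sublinear_scale[OF q, of t v] by simp
  qed
  have le: "r x v \<le> q (x + t *\<^sub>R v) - t * q v" if "t \<ge> 0" for x t
    unfolding r_def using that by (intro cINF_lower bdd) auto
  have ge: "c \<le> r x v" if "\<And>t. t \<ge> 0 \<Longrightarrow> c \<le> q (x + t *\<^sub>R v) - t * q v" for c x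
    unfolding r_def using that by (intro cINF_greatest) auto
  show "r x v \<le> q x"
    using le[of 0 x] by simp
  show "r (- v) v \<le> - q v"
    using le[of 1 "- v"] sublinear_zero[OF q] by simp
  have add: "r (x + y) v \<le> r x v + r y v" for x y
  proof -
    have 1: "r (x + y) v \<le> (q (x + s *\<^sub>R v) - s * q v) + (q (y + t *\<^sub>R v) - t * q v)"
      if "s \<ge> 0" "t \<ge> 0" for s t
      using le[of "s + t" "x + y"] sublinear_add[OF q, of "x + s *\<^sub>R v" "y + t *\<^sub>R v"] that
      by (simp add: algebra_simps)
    have "r (x + y) v - (q (x + s *\<^sub>R v) - s * q v) \<le> r y v" if "s \<ge> 0" for s
    proof (rule ge)
      fix t :: real assume "t \<ge> 0"
      then show "r (x + y) v - (q (x + s *\<^sub>R v) - s * q v) \<le> q (y + t *\<^sub>R v) - t * q v"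
        using 1[OF that, of t] by linarith
    qed
    then have "r (x + y) v - r y v \<le> r x v"
      by (intro ge) (simp add: algebra_simps)
    then show ?thesis by simp
  qed
  have zero: "r 0 v = 0"
    using le[of 0 0] ge[of 0 0] sublinear_scale[OF q] sublinear_zero[OF q]
    by (intro antisym) auto
  have scale_le: "c * r x v \<le> r (c *\<^sub>R x) v" if "c > 0" for c x
  proof (rule ge)
    fix t :: real assume t: "t \<ge> 0"
    have "c * r x v \<le> c * (q (x + (t / c) *\<^sub>R v) - (t / c) * q v)"
      using that t by (intro mult_left_mono le) auto
    also have "\<dots> = q (c *\<^sub>R (x + (t / c) *\<^sub>R v)) - t * q v"
      using that sublinear_scale[OF q, of c] by (simp add: right_diff_distrib)
    finally show "c * r x v \<le> q (c *\<^sub>R x + t *\<^sub>R v) - t * q v"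
      using that by (simp add: scaleR_right_distrib)
  qed
  have "r (c *\<^sub>R x) v = c * r x v" if "c \<ge> 0" for c x
  proof (cases "c = 0")
    case False
    with that have c: "c > 0" by simp
    have "inverse c * r (c *\<^sub>R x) v \<le> r x v"
      using scale_le[of "inverse c" "c *\<^sub>R x"] c by simp
    then have "r (c *\<^sub>R x) v \<le> c * r x v"
      using c by (simp add: field_simps)
    then show ?thesis using scale_le[OF c, of x] by simp
  qed (simp add: zero)
  with add show "sublinear (\<lambda>x. r x v)"
    by (simp add: sublinear_def)
qed

text \<open>Supplies the bounds of chains for Zorn's lemma. Subadditivity comes from the chain
  condition: of two members, the smaller one at \<open>x + y\<close> is bounded by the sum of their
  values at \<open>x\<close> and \<open>y\<close>. The common majorant keeps the infimum finite,
  since \<open>- p (- x)\<close> bounds every member from below at \<open>x\<close>.\<close>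

lemma sublinear_INF_chain:
  fixes C :: "('a::real_vector \<Rightarrow> real) set"
  assumes ne: "C \<noteq> {}" and sub: "\<And>q. q \<in> C \<Longrightarrow> sublinear q"
    and chain: "\<And>q r. q \<in> C \<Longrightarrow> r \<in> C \<Longrightarrow> q \<le> r \<or> r \<le> q"
    and dom: "\<And>q. q \<in> C \<Longrightarrow> q \<le> p"
  shows "sublinear (\<lambda>x. INF q\<in>C. q x)" "q \<in> C \<Longrightarrow> (\<lambda>x. INF q\<in>C. q x) \<le> q"
proof -
  have bdd: "bdd_below ((\<lambda>q. q x) ` C)" for x
  proof (rule bdd_belowI2)
    fix q assume q: "q \<in> C"
    show "- p (- x) \<le> q x"
      using sublinear_minus[OF sub[OF q], of x] dom[OF q] by (auto simp: le_fun_def intro: order_trans[rotated])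
  qed
  have le: "(INF q\<in>C. q x) \<le> q x" if "q \<in> C" for q x
    using bdd that by (rule cINF_lower)
  then show "q \<in> C \<Longrightarrow> (\<lambda>x. INF q\<in>C. q x) \<le> q"
    by (simp add: le_fun_def)
  have add: "(INF q\<in>C. q (x + y)) \<le> (INF q\<in>C. q x) + (INF q\<in>C. q y)" for x y
  proof -
    have 1: "(INF q\<in>C. q (x + y)) \<le> q x + r y" if qr: "q \<in> C" "r \<in> C" for q r
    proof -
      have "q (x + y) \<le> q x + r y \<or> r (x + y) \<le> q x + r y"
        using chain[OF qr] sublinear_add[OF sub[OF qr(1)], of x y] sublinear_add[OF sub[OF qr(2)], of x y]
        by (force simp: le_fun_def intro: order_trans)
      then show ?thesis
        using le[OF qr(1), of "x + y"] le[OF qr(2), of "x + y"] by linarith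
    qed
    have "(INF q\<in>C. q (x + y)) - q x \<le> (INF q\<in>C. q y)" if "q \<in> C" for q
      using 1[OF that] by (intro cINF_greatest ne) (simp add: algebra_simps)
    then have "(INF q\<in>C. q (x + y)) - (INF q\<in>C. q y) \<le> (INF q\<in>C. q x)"
      by (intro cINF_greatest ne) (simp add: algebra_simps)
    then show ?thesis by simp
  qed
  have scale_le: "c * (INF q\<in>C. q x) \<le> (INF q\<in>C. q (c *\<^sub>R x))" if "c \<ge> 0" for c x
    using that le by (intro cINF_greatest ne) (simp add: sublinear_scale sub mult_left_mono)
  have "(INF q\<in>C. q (c *\<^sub>R x)) = c * (INF q\<in>C. q x)" if "c \<ge> 0" for c x
  proof (cases "c = 0")
    case True
    then show ?thesis using ne by (simp add: sublinear_zero sub)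
  next
    case False
    with that have c: "c > 0" by simp
    have "inverse c * (INF q\<in>C. q (c *\<^sub>R x)) \<le> (INF q\<in>C. q x)"
      using scale_le[of "inverse c" "c *\<^sub>R x"] c by simp
    then have "(INF q\<in>C. q (c *\<^sub>R x)) \<le> c * (INF q\<in>C. q x)"
      using c by (simp add: field_simps)
    then show ?thesis using scale_le[OF that, of x] by simp
  qed
  with add show "sublinear (\<lambda>x. INF q\<in>C. q x)"
    by (simp add: sublinear_def)
qed

text \<open>Minimality makes \<open>q\<close> equal to its own shift along \<open>v\<close>, whose
  value at \<open>- v\<close> is at most \<open>- q v\<close>; hence \<open>q\<close> is odd, and an
  odd sublinear functional is linear.\<close>

lemma minimal_sublinear_imp_linear:
  fixes q :: "'a::real_vector \<Rightarrow> real"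
  assumes q: "sublinear q" and min: "\<And>r. sublinear r \<Longrightarrow> r \<le> q \<Longrightarrow> r = q"
  shows "linear q"
proof -
  have minus: "q (- v) = - q v" for v
  proof -
    define r where "r = (\<lambda>x. INF t\<in>{0..}. q (x + t *\<^sub>R v) - t * q v)"
    have "r = q"
      unfolding r_def using sublinear_shift[OF q] by (intro min) (auto simp: le_fun_def)
    moreover have "r (- v) \<le> - q v"
      unfolding r_def by (rule sublinear_shift(3)[OF q])
    ultimately have "q (- v) \<le> - q v" by simp
    then show ?thesis
      using sublinear_minus[OF q, of v] by simp
  qed
  show ?thesis
  proof (rule linearI)
    fix x y
    show "q (x + y) = q x + q y"
      using sublinear_add[OF q, of x y] sublinear_add[OF q, of "- x" "- y"] minus[of x] minus[of y]
        minus[of "x + y"] by simp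
  next
    fix c x
    show "q (c *\<^sub>R x) = c *\<^sub>R q x"
      using sublinear_scale[OF q, of c x] sublinear_scale[OF q, of "- c" x] minus[of "c *\<^sub>R x"]
      by (cases "c \<ge> 0") auto
  qed
qed

text \<open>Linear functionals are the minimal sublinear ones, so no extension from subspaces is needed.\<close>

theorem Hahn_Banach_dominated:
  fixes p :: "'a::real_vector \<Rightarrow> real"
  assumes p: "sublinear p"
  obtains l where "linear l" "l \<le> p"
proof -
  define A where "A = {q. sublinear q \<and> q \<le> p}"
  \<comment> \<open>Zorn's lemma for the reversed order: a maximal element is a minimal functional,
    and the upper bound of a nonempty chain is its pointwise infimum.\<close>
  have "\<exists>m\<in>A. \<forall>a\<in>A. m \<ge> a \<longrightarrow> a = m"
  proof (rule predicate_Zorn)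
    show "partial_order_on A (relation_of (\<ge>) A)"
      by (rule partial_order_on_relation_ofI) auto
  next
    fix C assume C: "C \<in> Chains (relation_of (\<ge>) A)"
    then have sub: "q \<in> A" if "q \<in> C" for q
      using that by (auto simp: Chains_def relation_of_def)
    have chain: "q \<le> r \<or> r \<le> q" if "q \<in> C" "r \<in> C" for q r
      using C that by (auto simp: Chains_def relation_of_def)
    show "\<exists>u\<in>A. \<forall>a\<in>C. a \<ge> u"
    proof (cases "C = {}")
      case True
      then show ?thesis using p by (auto simp: A_def)
    next
      case False
      have "sublinear (\<lambda>x. INF q\<in>C. q x)" and le: "(\<lambda>x. INF q\<in>C. q x) \<le> q" if "q \<in> C" for q
        using sub that sublinear_INF_chain[OF False _ chain, of p] by (auto simp: A_def)
      moreover obtain q where "q \<in> C" using False by blast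
      ultimately have "(\<lambda>x. INF q\<in>C. q x) \<in> A"
        using sub unfolding A_def by (blast intro: order_trans)
      with le show ?thesis by blast
    qed
  qed
  then obtain m where m: "m \<in> A" "\<And>a. a \<in> A \<Longrightarrow> a \<le> m \<Longrightarrow> a = m" by blast
  have "linear m"
    using m by (intro minimal_sublinear_imp_linear) (auto simp: A_def intro: order_trans)
  with m(1) show thesis by (intro that[of m]) (auto simp: A_def)
qed

lemma exists_norming_functional:
  fixes v :: "'a::real_normed_vector"
  obtains p :: "'a \<Rightarrow>\<^sub>L real" where "norm p \<le> 1" "blinfun_apply p v = norm v"
proof -
  \<comment> \<open>Any linear functional below \<open>r\<close> is forced to take the value \<open>norm v\<close> at \<open>v\<close>.\<close>
  define r where "r = (\<lambda>x. INF t\<in>{0..}. norm (x + t *\<^sub>R v) - t * norm v)"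
  have r: "sublinear r" "r x \<le> norm x" "r (- v) \<le> - norm v" for x
    unfolding r_def using sublinear_shift[OF sublinear_norm] by blast+
  obtain l where l: "linear l" "l \<le> r"
    using Hahn_Banach_dominated[OF r(1)] .
  have le: "l x \<le> norm x" for x
    using l(2) r(2)[of x] by (auto simp: le_fun_def intro: order_trans)
  have abs: "norm (l x) \<le> norm x * 1" for x
    using le[of x] le[of "- x"] linear_neg[OF l(1), of x] by (simp add: abs_le_iff)
  have bl: "bounded_linear l"
    using abs linear_add[OF l(1)] linear_cmul[OF l(1)] by (intro bounded_linear_intro[of l 1]) auto
  have "l (- v) \<le> - norm v"
    using l(2) r(3) by (auto simp: le_fun_def intro: order_trans)
  then have "l v = norm v"
    using le[of v] linear_neg[OF l(1), of v] by simp
  moreover have "norm (Blinfun l) \<le> 1"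
    using abs by (intro norm_blinfun_bound) (auto simp: bounded_linear_Blinfun_apply[OF bl])
  ultimately show thesis
    by (intro that[of "Blinfun l"]) (auto simp: bounded_linear_Blinfun_apply[OF bl])
qed


section \<open>Dyadic series and Simons' argument\<close>

text \<open>After rescaling, \<open>g n\<close>, ..., \<open>g (n + k - 1)\<close> carry the weights
  1/2, ..., 1/2^k; giving the missing weight 1/2^k to \<open>x\<close> makes this a convex
  combination.\<close>

lemma dyadic_tail_mem_convex:
  fixes C :: "'a::real_vector set"
  assumes C: "convex C" "\<And>k. k \<ge> n \<Longrightarrow> g k \<in> C"
    and h: "\<And>k. h (Suc k) = h k + (1/2) ^ Suc k *\<^sub>R g k"
    and x: "x \<in> C"
  shows "2 ^ n *\<^sub>R (h (n + k) - h n) + (1/2) ^ k *\<^sub>R x \<in> C"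
  using x
proof (induction k arbitrary: x)
  case (Suc k)
  \<comment> \<open>The last term is absorbed into the filler point: the induction hypothesis is
    applied to the midpoint of \<open>g (n + k)\<close> and \<open>x\<close>.\<close>
  have "(1/2) *\<^sub>R g (n + k) + (1/2) *\<^sub>R x \<in> C"
    using convexD[OF C(1) C(2) Suc.prems] by simp
  from Suc.IH[OF this] show ?case
    by (simp add: h algebra_simps power_add power_divide)
qed simp

text \<open>The rescaled remainder is the limit of finite convex combinations in \<open>C n\<close>
  whose filler \<open>g n\<close> has weight tending to 0, so closedness keeps it in
  \<open>C n\<close>.\<close>

lemma dyadic_series_converges:
  fixes C :: "nat \<Rightarrow> 'a::real_normed_vector set"
  assumes complete: "complete (UNIV :: 'a set)"
    and C: "\<And>n. convex (C n)" "\<And>n. closed (C n)" "\<And>n k. n \<le> k \<Longrightarrow> g k \<in> C n"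
    and bdd: "\<And>n x. x \<in> C n \<Longrightarrow> norm x \<le> M"
    and h: "\<And>k. h (Suc k) = h k + (1/2) ^ Suc k *\<^sub>R g k"
  obtains l where "h \<longlonglongrightarrow> l" "\<And>n. 2 ^ n *\<^sub>R (l - h n) \<in> C n"
proof -
  have mem: "2 ^ n *\<^sub>R (h (n + k) - h n) + (1/2) ^ k *\<^sub>R g n \<in> C n" for n k
    by (intro dyadic_tail_mem_convex[where g = g] C h order_refl)
  have norm_diff: "norm (h (n + k) - h n) \<le> 2 * M * (1/2) ^ n" for n k
  proof -
    have g: "norm ((1/2) ^ k *\<^sub>R g n) \<le> M"
      using bdd[OF C(3)[OF order_refl, of n]] mult_left_le_one_le[of "norm (g n)" "(1/2) ^ k"]
      by (simp add: power_le_one)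
    \<comment> \<open>One \<open>M\<close> bounds the convex combination, the other the filler that
      is subtracted from it.\<close>
    have "norm (2 ^ n *\<^sub>R (h (n + k) - h n)) \<le> 2 * M"
      using bdd[OF mem[of n k]] g
        norm_triangle_ineq4[of "2 ^ n *\<^sub>R (h (n + k) - h n) + (1/2) ^ k *\<^sub>R g n" "(1/2) ^ k *\<^sub>R g n"]
      by simp
    then have "2 ^ n * norm (h (n + k) - h n) \<le> 2 * M"
      by simp
    then show ?thesis
      by (simp add: power_divide field_simps)
  qed
  have "Cauchy h"
  proof (rule metric_CauchyI)
    fix e :: real assume e: "e > 0"
    have "(\<lambda>n. 2 * M * (1/2) ^ n) \<longlonglongrightarrow> 2 * M * 0"
      by (intro tendsto_intros) auto
    then have "\<forall>\<^sub>F n in sequentially. 2 * M * (1/2) ^ n < e / 2"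
      using e by (intro order_tendstoD) auto
    then obtain N where N: "2 * M * (1/2) ^ N < e / 2"
      by (auto simp: eventually_sequentially)
    have near: "dist (h m) (h N) < e / 2" if "m \<ge> N" for m
      using norm_diff[of N "m - N"] that N by (simp add: dist_norm)
    show "\<exists>N. \<forall>m\<ge>N. \<forall>n\<ge>N. dist (h m) (h n) < e"
      using near dist_triangle_half_r[of "h N" _ e] by (metis dist_commute)
  qed
  then obtain l where l: "h \<longlonglongrightarrow> l"
    using complete by (auto simp: complete_def)
  have "2 ^ n *\<^sub>R (l - h n) \<in> C n" for n
  proof (rule Lim_in_closed_set[OF C(2)])
    show "(\<lambda>k. 2 ^ n *\<^sub>R (h (n + k) - h n) + (1/2) ^ k *\<^sub>R g n) \<longlonglongrightarrow> 2 ^ n *\<^sub>R (l - h n)"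
    proof -
      have "(\<lambda>k. h (n + k)) \<longlonglongrightarrow> l"
        using LIMSEQ_ignore_initial_segment[OF l, of n] by (simp add: add.commute)
      then have "(\<lambda>k. 2 ^ n *\<^sub>R (h (n + k) - h n) + (1/2) ^ k *\<^sub>R g n)
          \<longlonglongrightarrow> 2 ^ n *\<^sub>R (l - h n) + 0 *\<^sub>R g n"
        by (intro tendsto_intros) auto
      then show ?thesis by simp
    qed
  qed (use mem in auto)
  with l show thesis by (rule that)
qed

text \<open>Of the function space only this is kept: every norm is attained by some functional along
  which \<open>f\<close> tends to 0. Such functionals form a James boundary, and
  \<open>\<phi>\<close> may depend on \<open>h\<close>.\<close>

theorem zero_in_closed_convex_hull_if_norming:
  fixes f :: "nat \<Rightarrow> 'a::real_normed_vector"
  assumes complete: "complete (UNIV :: 'a set)"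
    and bdd: "\<And>n. norm (f n) \<le> M"
    and norming: "\<And>h. \<exists>\<phi>. bounded_linear \<phi> \<and> (\<forall>x. \<phi> x \<le> norm x) \<and> \<phi> h = norm h \<and>
                    (\<lambda>n. \<phi> (f n)) \<longlonglongrightarrow> 0"
  shows "0 \<in> closure (convex hull (range f))"
proof (rule ccontr)
  assume nz: "0 \<notin> closure (convex hull (range f))"
  define C where "C n = closure (convex hull (f ` {n..}))" for n
  have C: "convex (C n)" "closed (C n)" for n
    by (auto simp: C_def)
  have f_in: "f n \<in> C n" for n
    unfolding C_def by (intro subsetD[OF closure_subset] hull_inc) auto
  have anti: "C k \<subseteq> C n" if "n \<le> k" for n k
    unfolding C_def using that by (intro closure_mono hull_mono image_mono) auto
  have C_sub: "C n \<subseteq> S" if "closed S" "convex S" "\<And>k. k \<ge> n \<Longrightarrow> f k \<in> S" for n S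
    unfolding C_def using that by (intro closure_minimal hull_minimal) auto
  have C_bdd: "norm x \<le> M" if "x \<in> C n" for n x
    using C_sub[of "cball 0 M" n] bdd that by auto
  obtain \<delta> where \<delta>: "\<delta> > 0" "\<And>x. x \<in> C 0 \<Longrightarrow> \<delta> \<le> norm x"
  proof -
    have "0 \<in> - C 0" "open (- C 0)"
      using nz C by (auto simp: C_def)
    then obtain e where "e > 0" "ball 0 e \<subseteq> - C 0"
      by (meson open_contains_ball)
    then show thesis
      by (intro that[of e]) (auto simp: subset_eq not_less[symmetric])
  qed
  \<comment> \<open>The infimum need not be attained. The tolerance \<open>\<delta> / 8\<close>
    times 4^(-n) is small against the decay 2^(-n) of the gaps \<open>D n\<close>.\<close>
  have "\<exists>g\<in>C n. \<forall>g'\<in>C n. norm (y + (1/2) ^ Suc n *\<^sub>R g) \<le>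
          norm (y + (1/2) ^ Suc n *\<^sub>R g') + \<delta> / 8 * ((1/2) ^ n)\<^sup>2" for n y
  proof -
    let ?I = "INF g\<in>C n. norm (y + (1/2) ^ Suc n *\<^sub>R g)"
    have bb: "bdd_below ((\<lambda>g. norm (y + (1/2) ^ Suc n *\<^sub>R g)) ` C n)"
      by (rule bdd_belowI2[of _ 0]) simp
    have "?I < ?I + \<delta> / 8 * ((1/2) ^ n)\<^sup>2"
      using \<delta>(1) by simp
    then obtain g where "g \<in> C n" "norm (y + (1/2) ^ Suc n *\<^sub>R g) < ?I + \<delta> / 8 * ((1/2) ^ n)\<^sup>2"
      using cINF_less_iff[OF _ bb] f_in by blast
    moreover have "?I \<le> norm (y + (1/2) ^ Suc n *\<^sub>R g')" if "g' \<in> C n" for g'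
      using bb that by (rule cINF_lower)
    ultimately show ?thesis by (intro bexI[of _ g]) force+
  qed
  then obtain pick where pick: "\<And>n y. pick n y \<in> C n"
    "\<And>n y g. g \<in> C n \<Longrightarrow> norm (y + (1/2) ^ Suc n *\<^sub>R pick n y) \<le>
          norm (y + (1/2) ^ Suc n *\<^sub>R g) + \<delta> / 8 * ((1/2) ^ n)\<^sup>2"
    by metis
  define h where "h = rec_nat 0 (\<lambda>n y. y + (1/2) ^ Suc n *\<^sub>R pick n y)"
  define g where "g n = pick n (h n)" for n
  have h0: "h 0 = 0" and hS: "h (Suc n) = h n + (1/2) ^ Suc n *\<^sub>R g n" for n
    by (auto simp: h_def g_def)
  have g_in: "g k \<in> C n" if "n \<le> k" for n k
    using anti[OF that] pick(1) by (auto simp: g_def)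
  have "\<exists>l. h \<longlonglongrightarrow> l \<and> (\<forall>n. 2 ^ n *\<^sub>R (l - h n) \<in> C n)"
    by (rule dyadic_series_converges[where C = C and g = g and h = h, OF complete C g_in C_bdd hS]) blast+
  then obtain l where l: "h \<longlonglongrightarrow> l" "\<And>n. 2 ^ n *\<^sub>R (l - h n) \<in> C n"
    by blast
  define D where "D n = norm l - norm (h n)" for n
  have D_step: "D (Suc n) \<ge> D n / 2 - \<delta> / 8 * ((1/2) ^ n)\<^sup>2" for n
  proof -
    \<comment> \<open>The competitor is the rescaled remainder, which turns the next partial sum
      into the midpoint of \<open>h n\<close> and \<open>l\<close>.\<close>
    have "norm (h (Suc n)) \<le> norm (h n + (1/2) ^ Suc n *\<^sub>R (2 ^ n *\<^sub>R (l - h n))) + \<delta> / 8 * ((1/2) ^ n)\<^sup>2"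
      unfolding hS g_def using l(2) by (rule pick)
    also have "h n + (1/2) ^ Suc n *\<^sub>R (2 ^ n *\<^sub>R (l - h n)) = (1/2) *\<^sub>R (l + h n)"
      by (simp add: power_divide algebra_simps flip: scaleR_add_left)
    also have "norm ((1/2) *\<^sub>R (l + h n)) \<le> (norm l + norm (h n)) / 2"
      using norm_triangle_ineq[of l "h n"] by simp
    finally show ?thesis by (simp add: D_def field_simps)
  qed
  \<comment> \<open>The extra 4^(-n) term pays for the tolerances: halving leaves
    \<open>\<delta> / 4\<close> times 4^(-n), and subtracting \<open>\<delta> / 8\<close> times
    4^(-n) leaves exactly the extra term for \<open>Suc n\<close>.\<close>
  have D_lower: "D n \<ge> (1/2) ^ n * (\<delta> / 2 + \<delta> / 2 * (1/2) ^ n)" for n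
  proof (induction n)
    case 0
    then show ?case using \<delta>(2)[OF l(2)[of 0]] by (simp add: D_def h0)
  next
    case (Suc n)
    then show ?case
      using D_step[of n] by (simp add: algebra_simps power2_eq_square)
  qed
  obtain \<phi> where \<phi>: "bounded_linear \<phi>" "\<And>x. \<phi> x \<le> norm x" "\<phi> l = norm l" "(\<lambda>n. \<phi> (f n)) \<longlonglongrightarrow> 0"
    using norming[of l] by blast
  interpret bounded_linear \<phi> by fact
  have lower: "\<phi> (2 ^ n *\<^sub>R (l - h n)) \<ge> \<delta> / 2" for n
  proof -
    have "(1/2) ^ n * (\<delta> / 2) \<le> (1/2) ^ n * (\<delta> / 2 + \<delta> / 2 * (1/2) ^ n)"
      using \<delta>(1) by (intro mult_left_mono) auto
    also have "\<dots> \<le> \<phi> (l - h n)"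
      using D_lower[of n] \<phi>(2)[of "h n"] \<phi>(3) by (simp add: D_def diff)
    finally show ?thesis
      unfolding scaleR by (simp add: power_divide field_simps)
  qed
  have "\<forall>\<^sub>F n in sequentially. \<phi> (f n) < \<delta> / 4"
    using \<phi>(4) \<delta>(1) by (intro order_tendstoD) auto
  then obtain N where N: "\<And>n. n \<ge> N \<Longrightarrow> \<phi> (f n) < \<delta> / 4"
    by (auto simp: eventually_sequentially)
  \<comment> \<open>A closed half-space containing the tail contains its closed hull, hence the
    rescaled remainder, where \<open>\<phi>\<close> is at least \<open>\<delta> / 2\<close>.\<close>
  have "C N \<subseteq> {x. \<phi> x \<le> \<delta> / 4}"
  proof (rule C_sub)
    show "closed {x. \<phi> x \<le> \<delta> / 4}"
      by (intro closed_Collect_le continuous_intros linear_continuous_on \<phi>(1))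
    show "convex {x. \<phi> x \<le> \<delta> / 4}"
      using convex_linear_vimage[OF linear, of "{..\<delta> / 4}"] by (simp add: vimage_def)
  qed (use N in \<open>auto intro: less_imp_le\<close>)
  with l(2)[of N] lower[of N] \<delta>(1) show False by auto
qed

section \<open>Bounded continuous functions on a countably compact space\<close>

text \<open>The library has the \<open>complete_space\<close> instance only for metric domains.\<close>

lemma complete_UNIV_bcontfun:
  "complete (UNIV :: ('a::topological_space \<Rightarrow>\<^sub>C 'b::complete_space) set)"
  unfolding complete_def
proof (intro allI impI)
  fix f :: "nat \<Rightarrow> 'a \<Rightarrow>\<^sub>C 'b"
  assume "(\<forall>n. f n \<in> UNIV) \<and> Cauchy f"
  then have "uniformly_Cauchy_on UNIV (\<lambda>n. apply_bcontfun (f n))"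
    unfolding uniformly_Cauchy_on_def Cauchy_def by (metis dist_fun_lt_imp_dist_val_lt)
  then obtain g where "uniform_limit UNIV (\<lambda>n. apply_bcontfun (f n)) g sequentially"
    using Cauchy_uniformly_convergent uniformly_convergent_on_def by blast
  then show "\<exists>l\<in>UNIV. f \<longlonglongrightarrow> l"
    by (auto elim: uniform_limit_bcontfunE)
qed

lemma countably_compact_continuous_image:
  fixes f :: "'a::topological_space \<Rightarrow> 'b::topological_space"
  assumes f: "continuous_on UNIV f" and c: "countably_compact (UNIV :: 'a set)"
  shows "countably_compact (range f)"
proof (rule countably_compactI)
  fix \<C> assume \<C>: "\<forall>t\<in>\<C>. open t" "range f \<subseteq> \<Union>\<C>" "countable \<C>"
  have "\<forall>t\<in>(\<lambda>t. f -` t) ` \<C>. open t"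
    using \<C>(1) f by (auto intro: open_vimage)
  moreover have "UNIV \<subseteq> \<Union>((\<lambda>t. f -` t) ` \<C>)" "countable ((\<lambda>t. f -` t) ` \<C>)"
    using \<C>(2,3) by blast+
  ultimately obtain \<D> where "\<D> \<subseteq> (\<lambda>t. f -` t) ` \<C>" "finite \<D>" "UNIV \<subseteq> \<Union>\<D>"
    by (rule countably_compactE[OF c])
  then obtain \<C>' where "\<C>' \<subseteq> \<C>" "finite \<C>'" "UNIV \<subseteq> \<Union>((\<lambda>t. f -` t) ` \<C>')"
    by (metis finite_subset_image)
  then show "\<exists>\<C>'\<subseteq>\<C>. finite \<C>' \<and> range f \<subseteq> \<Union>\<C>'"
    by (intro exI[of _ \<C>']) auto
qed

text \<open>The pointwise norms form a countably compact set of reals, which is compact because the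
  real line is second countable, so it has a maximum.\<close>

lemma norm_bcontfun_attained:
  fixes h :: "'a::topological_space \<Rightarrow>\<^sub>C 'b::real_normed_vector"
  assumes "countably_compact (UNIV :: 'a set)"
  obtains z where "norm (apply_bcontfun h z) = norm h"
proof -
  have "compact (range (\<lambda>z. norm (apply_bcontfun h z)))"
    unfolding countably_compact_eq_compact[symmetric]
    by (intro countably_compact_continuous_image assms continuous_intros) auto
  then obtain z where "\<And>y. norm (apply_bcontfun h y) \<le> norm (apply_bcontfun h z)"
    using compact_attains_sup[of "range (\<lambda>z. norm (apply_bcontfun h z))"] by auto
  then have "norm (apply_bcontfun h z) = norm h"
    by (intro antisym norm_bounded norm_bound)
  then show thesis by (rule that)
qed

lemma norm_bcontfun_eq_SUP:
  fixes h :: "'a::topological_space \<Rightarrow>\<^sub>C 'b::real_normed_vector"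
  shows "(SUP z. norm (apply_bcontfun h z)) = norm h"
proof (rule antisym)
  show "(SUP z. norm (apply_bcontfun h z)) \<le> norm h"
    by (intro cSUP_least norm_bounded) auto
  show "norm h \<le> (SUP z. norm (apply_bcontfun h z))"
    by (intro norm_bound cSUP_upper bdd_aboveI2[of _ _ "norm h"] norm_bounded) auto
qed

text \<open>Continuous maps from a countably compact space into \<open>'e\<close> are bounded, so
  working with bounded continuous functions loses no generality, and their norm is the supremum
  norm.\<close>

theorem corollary4:
  fixes f :: "nat \<Rightarrow> ('z::t2_space \<Rightarrow>\<^sub>C 'e::banach)"
  assumes "completely_regular_space (euclidean :: 'z topology)"
    and "countably_compact (UNIV :: 'z set)"
    and "\<exists>M. \<forall>n z. norm (apply_bcontfun (f n) z) \<le> M"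
    and "wstar_pointwise_null (\<lambda>n. apply_bcontfun (f n))"
  shows "\<exists>g :: nat \<Rightarrow> ('z \<Rightarrow>\<^sub>C 'e).
           (\<forall>k. g k \<in> convex hull (range f)) \<and>
           uniform_limit UNIV (\<lambda>k. apply_bcontfun (g k)) (\<lambda>z. 0) sequentially \<and>
           (\<lambda>k. SUP z. norm (apply_bcontfun (g k) z)) \<longlonglongrightarrow> 0"
proof -
  obtain M where M: "\<And>n. norm (f n) \<le> M"
    using assms(3) by (meson norm_bound)
  have "0 \<in> closure (convex hull (range f))"
  proof (rule zero_in_closed_convex_hull_if_norming[OF complete_UNIV_bcontfun M])
    fix h :: "'z \<Rightarrow>\<^sub>C 'e"
    \<comment> \<open>The functional norming \<open>h\<close> is evaluation at a point
      \<open>z\<close> where \<open>h\<close> attains its norm, followed by a \<open>p\<close>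
      norming the value there. The bound \<open>norm p \<le> 1\<close> gives domination by the
      supremum norm and puts \<open>p\<close> in the dual ball of the convergence
      hypothesis.\<close>
    obtain z where z: "norm (apply_bcontfun h z) = norm h"
      using norm_bcontfun_attained[OF assms(2)] .
    obtain p :: "'e \<Rightarrow>\<^sub>L real" where p: "norm p \<le> 1" "p (apply_bcontfun h z) = norm (apply_bcontfun h z)"
      using exists_norming_functional .
    have le: "norm (p (apply_bcontfun x z)) \<le> norm x * 1" for x :: "'z \<Rightarrow>\<^sub>C 'e"
    proof -
      have "norm (p (apply_bcontfun x z)) \<le> norm p * norm (apply_bcontfun x z)"
        by (rule norm_blinfun)
      also have "\<dots> \<le> 1 * norm x"
        by (intro mult_mono p norm_bounded) auto
      finally show ?thesis by simp
    qed
    have "bounded_linear (\<lambda>x. p (apply_bcontfun x z))"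
      using le by (intro bounded_linear_intro[of _ 1]) (auto simp: blinfun.add_right blinfun.scaleR_right)
    moreover have "\<forall>x. p (apply_bcontfun x z) \<le> norm x"
      using le by (auto simp: abs_le_iff)
    moreover have "(\<lambda>n. p (apply_bcontfun (f n) z)) \<longlonglongrightarrow> 0"
      using assms(4) p(1) by (auto simp: wstar_pointwise_null_def)
    ultimately show "\<exists>\<phi>. bounded_linear \<phi> \<and> (\<forall>x. \<phi> x \<le> norm x) \<and> \<phi> h = norm h \<and>
        (\<lambda>n. \<phi> (f n)) \<longlonglongrightarrow> 0"
      using p(2) z by (intro exI[of _ "\<lambda>x. p (apply_bcontfun x z)"]) simp
  qed
  then obtain g where g: "\<forall>k. g k \<in> convex hull (range f)" "g \<longlonglongrightarrow> 0"
    unfolding closure_sequential by blast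
  have "uniform_limit UNIV (\<lambda>k. apply_bcontfun (g k)) (\<lambda>z. 0) sequentially"
    using tendsto_bcontfun_uniform_limit[OF g(2)] by simp
  moreover have "(\<lambda>k. SUP z. norm (apply_bcontfun (g k) z)) \<longlonglongrightarrow> 0"
    unfolding norm_bcontfun_eq_SUP using g(2) by (rule tendsto_norm_zero)
  ultimately show ?thesis using g(1) by blast
qed

end
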